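(* Let $F$ be a finite field with $n = |F|$, and let $B$ be a subfield of $F$ such that $F$ has degree $t$ over $B$. Let $\mathcal{C} \subseteq F^n$ be the Reed-Solomon code of dimension $k = n - n/|B|$ whose evaluation points $\alpha_1,\ldots,\alpha_n$ are all the elements of $F$. Let $r \geq 2$ be an integer such that \[ t > \binom{r}{2} + \log_{|B|}\left( r\cdot\left(r+\binom{r}{2}(|B|-1)\right)\cdot (|B|-1) + 1\right). \] Then for all $I \subset [n]$ of size $r$, there is a matrix $M \in F^{n \times rt}$ that is a multiple-repair matrix for $I$, with bandwidth \[ b \leq (n-r)\cdot r - (|B| - 1)\binom{r}{2}. \]
   Context: Notation: $[n] = \{1,\ldots,n\}$. For $v,w \in F^n$, $\langle v,w\rangle = \sum_{i\in[n]} v_i w_i$. For a matrix $M$ with $n$ rows, $M[j,:]$ denotes its $j$-th row, and for $I \subseteq [n]$, $M[I,:]$ denotes the submatrix formed by the rows indexed by $I$. For a vector $v$, $\mathbf{set}(v)$ is the set of its entries. For $S \subseteq F$, $\mathrm{span}_B(S)$ is the $B$-linear span of $S$ in $F$ and $\dim_B$ is dimension over $B$. Reed-Solomon code: for distinct evaluation points $\alpha_1,\ldots,\alpha_n \in F$, the Reed-Solomon code of dimension $k$ over $F$ is $\mathcal{C} = \{ (f(\alpha_1), \ldots, f(\alpha_n)) : f \in F[X],\ \deg(f) < k \} \subseteq F^n$. The dual code is $\mathcal{C}^\perp = \{ v \in F^n : \langle c, v\rangle = 0 \text{ for all } c \in \mathcal{C}\}$. Multiple-repair matrix: for $I \subseteq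 [n]$ with $|I| = r$, a multiple-repair matrix with bandwidth $b$ for $I$ is a matrix $M \in F^{n \times rt}$ such that (1) the columns of $M$ are codewords of $\mathcal{C}^\perp$; (2) $M[I,:]$ has full rank over $B$, in the sense that $M[I,:]\cdot x \neq 0$ for all nonzero $x \in B^{rt}$; (3) $\sum_{j \in [n]\setminus I} \dim_B \mathrm{span}_B(\mathbf{set}(M[j,:])) = b$. *)

theory Defs
  imports
    "HOL-Library.Cardinality"
    "HOL-Algebra.Embedded_Algebras"
    "HOL-Algebra.Algebraic_Closure_Type"
    "Jordan_Normal_Form.Matrix"
    "Jordan_Normal_Form.DL_Submatrix"
begin

text \<open>
  Vectors and matrices are indexed from \<open>0\<close>, so the index set \<open>[n] = {1, \<dots>, n}\<close> is rendered
  as \<open>{..<n}\<close>. The big field is a type; a subfield is a subset of it, in the sense of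
  \<open>subfield\<close> for the ring structure \<open>ring_of_type_algebra\<close> carried by the type.
\<close>

text \<open>
  The zero polynomial has degree \<open>0\<close> here but belongs to the code for every \<open>k\<close>.
\<close>

definition reed_solomon :: "nat \<Rightarrow> nat \<Rightarrow> (nat \<Rightarrow> 'a::field) \<Rightarrow> 'a vec set" where
  "reed_solomon n k \<alpha> = {vec n (\<lambda>i. poly f (\<alpha> i)) |f. f = 0 \<or> degree f < k}"

definition dual_code :: "nat \<Rightarrow> 'a::field vec set \<Rightarrow> 'a vec set" where
  "dual_code n C = {v \<in> carrier_vec n. \<forall>c\<in>C. c \<bullet> v = 0}"

text \<open>
  \<open>ring.Span\<close> takes a list of generators, so the span of the set of entries of \<open>v\<close> is
  the span of the list of its entries.
\<close>

definition entries_span :: "'a::field set \<Rightarrow> 'a vec \<Rightarrow> 'a set" where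
  "entries_span B v = ring.Span ring_of_type_algebra B (list_of_vec v)"

text \<open>
  \<open>t\<close> is the degree of the ambient field over \<open>B\<close>.
\<close>

definition multiple_repair_matrix ::
    "'a::field set \<Rightarrow> nat \<Rightarrow> nat \<Rightarrow> 'a vec set \<Rightarrow> nat set \<Rightarrow> nat \<Rightarrow> 'a mat \<Rightarrow> bool" where
  "multiple_repair_matrix B t n C I b M \<longleftrightarrow>
     M \<in> carrier_mat n (card I * t) \<and>
     (\<forall>j < card I * t. col M j \<in> dual_code n C) \<and>
     (\<forall>x \<in> carrier_vec (card I * t). set\<^sub>v x \<subseteq> B \<and> x \<noteq> 0\<^sub>v (card I * t) \<longrightarrow>
        submatrix M I UNIV *\<^sub>v x \<noteq> 0\<^sub>v (card I)) \<and>
     (\<Sum>j \<in> {..<n} - I. ring.dim ring_of_type_algebra B (entries_span B (row M j))) = b"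

end

theory Submission
  imports Defs
begin

text \<open>
  Let \<open>q = |B|\<close>, let \<open>tr\<close> be the trace of \<open>F\<close> over \<open>B\<close>, and let \<open>a\<^sub>i\<close> (\<open>i < r\<close>) be the points indexed
  by \<open>I\<close>. The columns of \<open>M\<close> are the evaluations of \<open>\<delta>\<^sub>i tr (\<zeta>\<^sub>s (X - a\<^sub>i)) / (X - a\<^sub>i)\<close>, where \<open>\<zeta>\<close> is a
  basis of \<open>F\<close> over \<open>B\<close>. These polynomials have degree less than \<open>q\<^bsup>t - 1\<^esup> = n - k\<close>. Outside \<open>I\<close>, the
  row of \<open>M\<close> at \<open>x\<close> lies in the \<open>B\<close>-span of the \<open>r\<close> elements \<open>\<delta>\<^sub>i / (x - a\<^sub>i)\<close>, and one dimension is
  saved whenever two of them are proportional over \<open>B\<close>. For each pair \<open>i < j\<close> with \<open>\<delta>\<^sub>i / \<delta>\<^sub>j\<close> outside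
  \<open>B\<close> this happens at exactly \<open>q - 1\<close> points \<open>x\<close>.

  The multipliers \<open>\<delta>\<^sub>j\<close> are chosen one after the other. At most \<open>r choose 2\<close> linear conditions over \<open>B\<close>
  make \<open>M[I,:]\<close> nonsingular, and the solution space is larger than the set of values for which
  the collision points of two pairs would overlap or meet the points of \<open>I\<close>.
\<close>

section \<open>Subfields, spans and dimension inside a field type\<close>

lemma ring_of_type_algebra_simps:
  "carrier (ring_of_type_algebra :: 'a::field ring) = UNIV"
  "x \<otimes>\<^bsub>ring_of_type_algebra\<^esub> y = x * (y :: 'a)"
  "x \<oplus>\<^bsub>ring_of_type_algebra\<^esub> y = x + (y :: 'a)"
  "\<one>\<^bsub>ring_of_type_algebra\<^esub> = (1 :: 'a)"
  "\<zero>\<^bsub>ring_of_type_algebra\<^esub> = (0 :: 'a)"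
  by (simp_all add: ring_of_type_algebra_def)

lemma a_inv_ring_of_type_algebra: "\<ominus>\<^bsub>ring_of_type_algebra\<^esub> x = - (x :: 'a::field)"
proof -
  interpret ring "ring_of_type_algebra :: 'a ring" by (rule ring_from_type_algebra)
  have "x + \<ominus>\<^bsub>ring_of_type_algebra\<^esub> x = 0"
    using r_neg[of x] by (simp add: ring_of_type_algebra_simps)
  then show ?thesis by (simp add: add_eq_0_iff)
qed

lemma subfield_of_type_closed:
  fixes B :: "'a::field set"
  assumes "subfield B ring_of_type_algebra"
  shows "0 \<in> B" "1 \<in> B"
    and "x \<in> B \<Longrightarrow> y \<in> B \<Longrightarrow> x + y \<in> B"
    and "x \<in> B \<Longrightarrow> y \<in> B \<Longrightarrow> x * y \<in> B"
    and "x \<in> B \<Longrightarrow> - x \<in> B"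
    and "x \<in> B \<Longrightarrow> inverse x \<in> B"
proof -
  interpret ring "ring_of_type_algebra :: 'a ring" by (rule ring_from_type_algebra)
  note closed = subringE[OF subfieldE(1)[OF assms], unfolded ring_of_type_algebra_simps a_inv_ring_of_type_algebra]
  show "0 \<in> B" "1 \<in> B" "x \<in> B \<Longrightarrow> y \<in> B \<Longrightarrow> x + y \<in> B" "x \<in> B \<Longrightarrow> y \<in> B \<Longrightarrow> x * y \<in> B"
    "x \<in> B \<Longrightarrow> - x \<in> B" using closed by auto
  show "inverse x \<in> B" if "x \<in> B"
  proof (cases "x = 0")
    case False
    then have "inv\<^bsub>ring_of_type_algebra\<^esub> x \<in> B" "x * inv\<^bsub>ring_of_type_algebra\<^esub> x = 1"
      using subfield_m_inv[OF assms, of x] that by (auto simp: ring_of_type_algebra_simps)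
    then show ?thesis by (metis inverse_unique)
  qed (use \<open>0 \<in> B\<close> in simp)
qed

lemma combine_ring_of_type_algebra:
  fixes us ks :: "'a::field list"
  assumes "length ks = length us"
  shows "ring.combine ring_of_type_algebra ks us = (\<Sum>i<length us. ks ! i * us ! i)"
proof -
  interpret ring "ring_of_type_algebra :: 'a ring" by (rule ring_from_type_algebra)
  show ?thesis
    using assms
    by (induction rule: list_induct2)
       (simp_all add: ring_of_type_algebra_simps sum.lessThan_Suc_shift del: sum.lessThan_Suc)
qed

lemma dimension_Span_le_length:
  fixes B :: "'a::field set"
  assumes "subfield B ring_of_type_algebra"
  shows "\<exists>m\<le>length us. ring.dimension ring_of_type_algebra m B (ring.Span ring_of_type_algebra B us)"
proof -
  interpret ring "ring_of_type_algebra :: 'a ring" by (rule ring_from_type_algebra)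
  have carrier: "set us \<subseteq> carrier ring_of_type_algebra" for us :: "'a list"
    by (simp add: ring_of_type_algebra_simps)
  show ?thesis
  proof (induction us)
    case (Cons u us)
    then obtain m where m: "m \<le> length us" "dimension m B (Span B us)" by blast
    show ?case
    proof (cases "u \<in> Span B us")
      case True
      then have "Span B (u # us) = Span B us"
        using Span_base_incl[OF assms carrier, of us] mono_Span_subset[OF assms _ carrier, of "u # us" us]
          mono_Span[OF assms carrier, of u us] carrier[of "[u]"]
        by (auto simp del: Span.simps)
      then show ?thesis using m by (metis le_SucI length_Cons)
    next
      case False
      then have "dimension (Suc m) B (Span B (u # us))"
        using m(2) Suc_dim[of u "Span B us" m B] carrier[of "[u]"] by simp
      then show ?thesis using m(1) by (metis Suc_le_mono length_Cons)
    qed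
  qed simp
qed

text \<open>All generators lie in the span of the \<open>card J\<close> elements \<open>w i\<close>.
  For a row of the repair matrix \<open>w i\<close> will be \<open>\<delta> i / (x - a i)\<close>,
  and deleting an index from \<open>J\<close> records a saved dimension.\<close>

lemma dim_Span_le_card:
  fixes B :: "'a::field set"
  assumes "subfield B ring_of_type_algebra" "finite J"
    and multiples: "\<And>v. v \<in> set vs \<Longrightarrow> \<exists>i\<in>J. \<exists>b\<in>B. v = b * w i"
  shows "ring.dim ring_of_type_algebra B (ring.Span ring_of_type_algebra B vs) \<le> card J"
proof -
  interpret ring "ring_of_type_algebra :: 'a ring" by (rule ring_from_type_algebra)
  note B = assms(1)
  have carrier: "set us \<subseteq> carrier ring_of_type_algebra" for us :: "'a list"
    by (simp add: ring_of_type_algebra_simps)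
  obtain js where js: "set js = J" "distinct js"
    using finite_distinct_list[OF \<open>finite J\<close>] by blast
  have "b * w i \<in> Span B (map w js)" if "i \<in> J" "b \<in> B" for b i
    using Span_smult_closed[OF B carrier \<open>b \<in> B\<close>, of "w i" "map w js"]
      Span_base_incl[OF B carrier, of "map w js"] that js
    by (auto simp: ring_of_type_algebra_simps simp del: Span.simps)
  then have "set vs \<subseteq> Span B (map w js)"
    using multiples by blast
  then have le: "Span B vs \<subseteq> Span B (map w js)"
    by (rule mono_Span_subset[OF B _ carrier])
  obtain us where us: "independent B us" "Span B us = Span B vs"
    using filter_base[OF B carrier] by metis
  obtain m where m: "m \<le> card J" "dimension m B (Span B (map w js))"
    using dimension_Span_le_length[OF B, of "map w js"] distinct_card[OF js(2)] js(1) by auto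
  have "length us \<le> m"
    using independent_length_le_dimension[OF B m(2) us(1)] us le Span_base_incl[OF B carrier, of us]
    by (auto simp del: Span.simps)
  moreover have "dim B (Span B vs) = length us"
    using dimI[OF B dimension_independent[OF us(1)]] us(2) by (simp add: over_def)
  ultimately show ?thesis using m(1) by linarith
qed

lemma exists_basis_of_type:
  fixes B :: "'a::field set"
  assumes "subfield B ring_of_type_algebra"
    and "ring.dimension ring_of_type_algebra t B UNIV"
  obtains \<zeta> :: "nat \<Rightarrow> 'a" where
    "\<And>y. \<exists>x. (\<forall>s<t. x s \<in> B) \<and> y = (\<Sum>s<t. x s * \<zeta> s)"
    "\<And>x. (\<forall>s<t. x s \<in> B) \<Longrightarrow> (\<Sum>s<t. x s * \<zeta> s) = 0 \<Longrightarrow> \<forall>s<t. x s = 0"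
proof -
  interpret ring "ring_of_type_algebra :: 'a ring" by (rule ring_from_type_algebra)
  note B = assms(1)
  obtain us where us: "independent B us" "length us = t" "Span B us = UNIV"
    using exists_base[OF B assms(2)] by blast
  have carrier: "set us \<subseteq> carrier ring_of_type_algebra"
    by (simp add: ring_of_type_algebra_simps)
  show thesis
  proof
    fix y :: 'a
    obtain ks where "set ks \<subseteq> B" "length ks = length us" "y = combine ks us"
      using Span_mem_iff_length_version[OF B carrier, of y] us(3) by auto
    then show "\<exists>x. (\<forall>s<t. x s \<in> B) \<and> y = (\<Sum>s<t. x s * us ! s)"
      by (intro exI[of _ "\<lambda>s. ks ! s"]) (auto simp: combine_ring_of_type_algebra us(2))
  next
    fix x assume x: "\<forall>s<t. x s \<in> B" "(\<Sum>s<t. x s * us ! s) = 0"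
    let ?ks = "map x [0..<t]"
    have "set ?ks \<subseteq> B" "combine ?ks us = \<zero>\<^bsub>ring_of_type_algebra\<^esub>"
      using x us(2) by (auto simp: combine_ring_of_type_algebra ring_of_type_algebra_simps)
    then have "set ?ks \<subseteq> {0}"
      using independent_imp_trivial_combine[OF B us(1), of ?ks] us(2)
      by (simp add: ring_of_type_algebra_simps)
    then show "\<forall>s<t. x s = 0" by (auto simp: image_subset_iff)
  qed
qed

section \<open>Power sums and counting arguments in finite fields\<close>

text \<open>Multiplication by a nonzero \<open>x\<close> permutes \<open>K - {0}\<close>; compare
  the products over both sides. Closure under multiplication by \<open>x\<close> is all that is
  asked of \<open>K\<close>, so the lemma serves \<open>K = B\<close> as well as
  \<open>K = UNIV\<close>.\<close>

lemma power_card_eq_self: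
  fixes K :: "'a::field set"
  assumes "finite K" "0 \<in> K" "x \<in> K" and closed: "\<And>y. y \<in> K \<Longrightarrow> x * y \<in> K"
  shows "x ^ card K = x"
proof (cases "x = 0")
  case True
  then show ?thesis using assms card_gt_0_iff by fastforce
next
  case False
  let ?K = "K - {0}"
  have "inj_on ((*) x) ?K" using False by (auto intro: inj_onI)
  moreover have "(*) x ` ?K \<subseteq> ?K" using closed False by auto
  ultimately have "bij_betw ((*) x) ?K ?K"
    using \<open>finite K\<close> by (simp add: bij_betw_def endo_inj_surj)
  then have "(\<Prod>y\<in>?K. x * y) = \<Prod>?K" by (rule prod.reindex_bij_betw)
  then have "x ^ card ?K * \<Prod>?K = \<Prod>?K" by (simp add: prod.distrib)
  moreover have "\<Prod>?K \<noteq> 0" using \<open>finite K\<close> by simp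
  ultimately have "x ^ card ?K = 1" by simp
  moreover have "card K = Suc (card ?K)"
    using \<open>finite K\<close> \<open>0 \<in> K\<close> by (simp only: card.remove)
  ultimately show ?thesis by simp
qed

text \<open>The substitution of \<open>a * x\<close> for \<open>x\<close> shows that
  \<open>a ^ m - 1\<close> annihilates the sum, and \<open>X ^ m - 1\<close> has too few roots for
  this factor to vanish at every nonzero \<open>a\<close>. For \<open>m = 0\<close> all summands are
  1, also \<open>0 ^ 0\<close>, and the shift by 1 takes the place of the scaling.\<close>

lemma sum_power_UNIV_eq_0:
  assumes "m < CARD('a) - 1"
  shows "(\<Sum>x\<in>UNIV. x ^ m) = (0 :: 'a::{field,finite})"
proof (cases "m = 0")
  case True
  have "(\<Sum>x\<in>UNIV. x + 1) = (\<Sum>x\<in>UNIV. x :: 'a)"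
    by (rule sum.reindex_bij_betw) (auto intro!: bij_betwI[of _ _ _ "\<lambda>x. x - 1"])
  then show ?thesis using True by (simp add: sum.distrib)
next
  case False
  let ?p = "monom 1 m - 1 :: 'a poly"
  have deg: "degree ?p = m"
    using False degree_add_eq_left[of "-1" "monom (1::'a) m"] by (simp add: degree_monom_eq)
  then have "?p \<noteq> 0" using False by auto
  then have "card {x. poly ?p x = 0} \<le> m" using card_poly_roots_bound[of ?p] deg by simp
  moreover have "card (UNIV - {0 :: 'a}) = CARD('a) - 1" by simp
  ultimately have "\<not> UNIV - {0} \<subseteq> {x. poly ?p x = 0}"
    using assms card_mono[OF finite, of "UNIV - {0}" "{x. poly ?p x = 0}"] by linarith
  then obtain a :: 'a where a: "a \<noteq> 0" "a ^ m \<noteq> 1" by (auto simp: poly_monom)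
  have "(\<Sum>x\<in>UNIV. (a * x) ^ m) = (\<Sum>x\<in>UNIV. x ^ m)"
    by (rule sum.reindex_bij_betw[where g = "\<lambda>x. x ^ m"])
       (use a in \<open>auto intro!: bij_betwI[of _ _ _ "\<lambda>x. x / a"]\<close>)
  then have "(a ^ m - 1) * (\<Sum>x\<in>UNIV. x ^ m) = 0"
    by (simp add: power_mult_distrib sum_distrib_left[symmetric] left_diff_distrib)
  then show ?thesis using a by simp
qed

lemma sum_poly_UNIV_eq_0:
  fixes p :: "'a::{field,finite} poly"
  assumes "degree p < CARD('a) - 1"
  shows "(\<Sum>x\<in>UNIV. poly p x) = 0"
proof -
  have "(\<Sum>x\<in>UNIV. poly p x) = (\<Sum>x\<in>UNIV. \<Sum>i\<le>degree p. coeff p i * x ^ i)"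
    by (simp add: poly_altdef)
  also have "\<dots> = (\<Sum>i\<le>degree p. coeff p i * (\<Sum>x\<in>UNIV. x ^ i))"
    by (subst sum.swap) (simp add: sum_distrib_left)
  also have "\<dots> = 0"
    using assms by (intro sum.neutral) (auto simp: sum_power_UNIV_eq_0)
  finally show ?thesis .
qed

lemma card_pairs_less: "card {(i, j). i < j \<and> j < (r::nat)} = r choose 2"
proof (induction r)
  case (Suc r)
  have "{(i, j). i < j \<and> j < Suc r} = {(i, j). i < j \<and> j < r} \<union> (\<lambda>i. (i, r)) ` {..<r}"
    by auto
  moreover have "finite {(i, j). i < j \<and> j < r}"
    by (rule finite_subset[of _ "{..<r} \<times> {..<r}"]) auto
  ultimately have "card {(i, j). i < j \<and> j < Suc r} = (r choose 2) + r"
    using Suc by (simp only:, subst card_Un_disjoint) (auto simp: card_image inj_on_def)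
  then show ?case by (simp add: numeral_2_eq_2)
qed simp

text \<open>Rank-nullity by counting: pick a representative of each fibre of the joint map
  \<open>\<Phi>\<close>. An element is then determined by its value under \<open>\<Phi>\<close> and
  its difference from the representative, which lies in the common kernel.\<close>

lemma card_le_card_kernel_mult:
  fixes L :: "'l \<Rightarrow> 'a::{ab_group_add,finite} \<Rightarrow> 'b::ab_group_add"
  assumes "finite C" "finite B"
    and additive: "\<And>l x y. l \<in> C \<Longrightarrow> L l (x + y) = L l x + L l y"
    and range: "\<And>l x. l \<in> C \<Longrightarrow> L l x \<in> B"
  shows "CARD('a) \<le> card {x. \<forall>l\<in>C. L l x = 0} * card B ^ card C"
proof -
  define \<Phi> where "\<Phi> x = (\<lambda>l\<in>C. L l x)" for x
  define rep where "rep y = (SOME x. \<Phi> x = y)" for y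
  have rep: "\<Phi> (rep (\<Phi> x)) = \<Phi> x" for x
    unfolding rep_def by (rule someI[of "\<lambda>z. \<Phi> z = \<Phi> x"]) simp
  have diff: "L l (x - y) = L l x - L l y" if "l \<in> C" for l x y
    using additive[OF that, of "x - y" y] by simp
  have "L l (x - rep (\<Phi> x)) = 0" if "l \<in> C" for l x
    using fun_cong[OF rep[of x], of l] that by (simp add: diff \<Phi>_def)
  then have "(\<lambda>x. (x - rep (\<Phi> x), \<Phi> x)) ` UNIV \<subseteq> {x. \<forall>l\<in>C. L l x = 0} \<times> (C \<rightarrow>\<^sub>E B)"
    using range by (auto simp: \<Phi>_def)
  moreover have "inj (\<lambda>x. (x - rep (\<Phi> x), \<Phi> x))"
    by (rule injI) (metis Pair_inject diff_add_cancel)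
  moreover have "finite ({x. \<forall>l\<in>C. L l x = 0} \<times> (C \<rightarrow>\<^sub>E B))"
    using assms by (intro finite_cartesian_product finite_PiE) auto
  ultimately have "CARD('a) \<le> card ({x. \<forall>l\<in>C. L l x = 0} \<times> (C \<rightarrow>\<^sub>E B))"
    by (intro card_inj_on_le)
  then show ?thesis
    using \<open>finite C\<close> by (simp add: card_cartesian_product card_PiE)
qed

section \<open>The Frobenius map over a subfield\<close>

locale finite_field_over_subfield =
  fixes B :: "'a::{field,finite} set" and t :: nat
  assumes subfield: "subfield B ring_of_type_algebra"
    and dimension: "ring.dimension ring_of_type_algebra t B UNIV"
    and t_pos: "0 < t"
begin

abbreviation q :: nat where "q \<equiv> card B"

lemmas B_closed = subfield_of_type_closed[OF subfield]

lemma B_diff: "x \<in> B \<Longrightarrow> y \<in> B \<Longrightarrow> x - y \<in> B"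
  using B_closed(3)[of x "- y"] B_closed(5)[of y] by simp

lemma q_ge_2: "2 \<le> q"
  using card_mono[of B "{0, 1}"] B_closed(1,2) by simp

lemma card_field: "CARD('a) = q ^ t"
proof -
  obtain \<zeta> :: "nat \<Rightarrow> 'a" where span: "\<And>y. \<exists>x. (\<forall>s<t. x s \<in> B) \<and> y = (\<Sum>s<t. x s * \<zeta> s)"
    and indep: "\<And>x. (\<forall>s<t. x s \<in> B) \<Longrightarrow> (\<Sum>s<t. x s * \<zeta> s) = 0 \<Longrightarrow> \<forall>s<t. x s = 0"
    using exists_basis_of_type[OF subfield dimension] by blast
  define \<Phi> where "\<Phi> x = (\<Sum>s<t. x s * \<zeta> s)" for x
  have "inj_on \<Phi> ({..<t} \<rightarrow>\<^sub>E B)"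
  proof (rule inj_onI)
    fix x y assume *: "x \<in> {..<t} \<rightarrow>\<^sub>E B" "y \<in> {..<t} \<rightarrow>\<^sub>E B" "\<Phi> x = \<Phi> y"
    have "(\<Sum>s<t. (x s - y s) * \<zeta> s) = 0"
      using *(3) by (simp add: \<Phi>_def left_diff_distrib sum_subtractf)
    then have "\<forall>s<t. x s - y s = 0"
      using *(1,2) by (intro indep) (auto intro!: B_diff)
    then show "x = y" using *(1,2) by (intro PiE_ext[of x _ _ y]) auto
  qed
  moreover have "\<Phi> ` ({..<t} \<rightarrow>\<^sub>E B) = UNIV"
  proof (intro equalityI subsetI UNIV_I image_eqI)
    fix y :: 'a
    define x where "x = (SOME x. (\<forall>s<t. x s \<in> B) \<and> y = (\<Sum>s<t. x s * \<zeta> s))"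
    have x: "(\<forall>s<t. x s \<in> B) \<and> y = (\<Sum>s<t. x s * \<zeta> s)"
      unfolding x_def by (rule someI_ex[OF span])
    show "y = \<Phi> (restrict x {..<t})" "restrict x {..<t} \<in> {..<t} \<rightarrow>\<^sub>E B"
      using x by (auto simp: \<Phi>_def)
  qed
  ultimately have "card ({..<t} \<rightarrow>\<^sub>E B) = CARD('a)"
    by (metis card_image)
  then show ?thesis by (simp add: card_PiE)
qed

lemma power_q_eq_self: "x \<in> B \<Longrightarrow> x ^ q = x"
  by (rule power_card_eq_self) (auto simp: B_closed)

text \<open>The \<open>q\<close> elements of \<open>B\<close> already exhaust the roots of
  \<open>X ^ q - X\<close>.\<close>

lemma power_q_eq_self_iff: "x ^ q = x \<longleftrightarrow> x \<in> B"
proof -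
  let ?p = "monom 1 q + [:0, -1:] :: 'a poly"
  have "degree ?p = q"
    using degree_add_eq_left[of "[:0, -1:]" "monom (1::'a) q"] q_ge_2 by (simp add: degree_monom_eq)
  moreover from this have "?p \<noteq> 0" using q_ge_2 by auto
  ultimately have "card {x. poly ?p x = 0} \<le> q" using card_poly_roots_bound[of ?p] by simp
  moreover have "B \<subseteq> {x. poly ?p x = 0}"
    using power_q_eq_self by (auto simp: poly_monom)
  ultimately have "B = {x. poly ?p x = 0}" by (intro card_seteq) auto
  then have "x \<in> B \<longleftrightarrow> poly ?p x = 0" by blast
  then show ?thesis by (auto simp: poly_monom)
qed

text \<open>
  Instead of going through the characteristic: \<open>(X + 1)\<^sup>q - X\<^sup>q - 1\<close> has degree less than \<open>q\<close>,
  yet all \<open>q\<close> elements of \<open>B\<close> are roots of it.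
\<close>

lemma frobenius_add_one: "(x + 1) ^ q = x ^ q + (1 :: 'a)"
proof -
  let ?p = "[:1, 1:] ^ q - monom 1 q - 1 :: 'a poly"
  have "degree ?p < q \<or> ?p = 0"
  proof -
    have deg: "degree ([:1, 1:] ^ q :: 'a poly) = q" by (simp add: degree_power_eq)
    have "coeff ([:1, 1:] ^ q :: 'a poly) q = 1"
      using lead_coeff_power[of "[:1, 1:] :: 'a poly" q] deg by simp
    then have "coeff ?p q = 0" using q_ge_2 by (auto simp: coeff_1)
    moreover have "degree ?p \<le> q"
      using deg by (intro degree_diff_le) (auto simp: degree_monom_eq)
    ultimately show ?thesis
      by (metis leading_coeff_0_iff le_neq_implies_less)
  qed
  moreover have False if "degree ?p < q" "?p \<noteq> 0"
  proof -
    have "B \<subseteq> {x. poly ?p x = 0}"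
      using power_q_eq_self B_closed by (auto simp: poly_monom add.commute)
    then have "q \<le> card {x. poly ?p x = 0}" by (intro card_mono) auto
    then show False using card_poly_roots_bound[of ?p] that by linarith
  qed
  ultimately have "poly ?p x = 0" by (metis poly_0)
  then show ?thesis by (simp add: poly_monom add.commute algebra_simps)
qed

lemma frobenius_add: "(x + y) ^ q = x ^ q + (y :: 'a) ^ q"
proof (cases "y = 0")
  case True
  then show ?thesis using q_ge_2 by simp
next
  case False
  have "(x + y) ^ q = (x / y + 1) ^ q * y ^ q"
    using False by (simp add: power_mult_distrib[symmetric] field_simps)
  also have "\<dots> = x ^ q + y ^ q"
    using False by (simp add: frobenius_add_one distrib_right power_divide)
  finally show ?thesis .
qed

lemma frobenius_power_add: "(x + y) ^ (q ^ s) = x ^ (q ^ s) + (y :: 'a) ^ (q ^ s)"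
  by (induction s arbitrary: x y) (simp_all add: power_mult frobenius_add)

lemma frobenius_sum: "(\<Sum>i\<in>S. f i :: 'a) ^ q = (\<Sum>i\<in>S. f i ^ q)"
  using q_ge_2 by (induction S rule: infinite_finite_induct) (simp_all add: frobenius_add)

section \<open>The trace and the polynomials built from it\<close>

definition trace :: "'a \<Rightarrow> 'a" where "trace x = (\<Sum>s<t. x ^ (q ^ s))"

lemma trace_add: "trace (x + y) = trace x + trace y"
  by (simp add: trace_def frobenius_power_add sum.distrib)

lemma trace_0 [simp]: "trace 0 = 0"
  using trace_add[of 0 0] by (metis add_cancel_right_right add_0)

lemma trace_sum: "trace (\<Sum>i\<in>S. f i) = (\<Sum>i\<in>S. trace (f i))"
  by (induction S rule: infinite_finite_induct) (simp_all add: trace_add)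

lemma trace_minus: "trace (- x) = - trace x"
  using trace_add[of x "- x"] by (simp add: eq_neg_iff_add_eq_0 add.commute)

lemma power_q_power_eq_self: "b \<in> B \<Longrightarrow> b ^ (q ^ s) = b"
  by (induction s) (simp_all add: power_mult power_q_eq_self)

lemma trace_scale: "b \<in> B \<Longrightarrow> trace (b * x) = b * trace x"
  by (simp add: trace_def power_mult_distrib power_q_power_eq_self sum_distrib_left)

lemma trace_in_B: "trace x \<in> B"
proof -
  \<comment> \<open>The Frobenius map shifts the summands by one place: \<open>x\<close> drops out
    and \<open>x ^ (q ^ t)\<close>, which equals \<open>x\<close>, comes in. So the trace is fixed
    and hence in \<open>B\<close>.\<close>
  have "trace x ^ q = (\<Sum>s<t. x ^ (q ^ Suc s))"
    by (simp add: trace_def frobenius_sum power_mult[symmetric] mult.commute)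
  also have "\<dots> = trace x - x + x ^ (q ^ t)"
    using sum.lessThan_Suc_shift[of "\<lambda>s. x ^ (q ^ s)" t] by (simp add: trace_def algebra_simps)
  also have "x ^ (q ^ t) = x"
    using power_card_eq_self[of UNIV x] by (simp add: card_field)
  finally show ?thesis by (simp add: power_q_eq_self_iff)
qed

text \<open>The polynomial \<open>tr (z (X - a)) / (X - a)\<close> of Guruswami and Wootters.\<close>

definition trace_poly :: "'a \<Rightarrow> 'a \<Rightarrow> 'a poly" where
  "trace_poly z a = (\<Sum>s<t. smult (z ^ (q ^ s)) ([:- a, 1:] ^ (q ^ s - 1)))"

text \<open>The summand \<open>s = t - 1\<close> dominates. With \<open>n - k = q ^ (t - 1)\<close>
  this is exactly small enough for the evaluations to be dual codewords.\<close>

lemma degree_trace_poly: "degree (trace_poly z a) \<le> q ^ (t - 1) - 1"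
  unfolding trace_poly_def
proof (rule degree_sum_le)
  fix s assume "s \<in> {..<t}"
  then have "q ^ s \<le> q ^ (t - 1)" using q_ge_2 by (intro power_increasing) auto
  then show "degree (smult (z ^ (q ^ s)) ([:- a, 1:] ^ (q ^ s - 1))) \<le> q ^ (t - 1) - 1"
    by (intro order_trans[OF degree_smult_le]) (simp add: degree_power_eq)
qed simp

lemma poly_trace_poly: "(x - a) * poly (trace_poly z a) x = trace (z * (x - a))"
proof -
  have "y * (z ^ m * y ^ (m - 1)) = (z * y) ^ m" if "m > 0" for y :: 'a and m
    using that by (cases m) (simp_all add: power_mult_distrib)
  then show ?thesis
    using q_ge_2 by (simp add: trace_poly_def trace_def poly_sum sum_distrib_left)
qed

lemma poly_trace_poly_eq: "x \<noteq> a \<Longrightarrow> poly (trace_poly z a) x = trace (z * (x - a)) / (x - a)"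
  using poly_trace_poly[of x a z] by (simp add: field_simps)

text \<open>Only \<open>s = 0\<close> has exponent \<open>q ^ s - 1 = 0\<close>; every other power
  vanishes at \<open>a\<close>. This value gives the diagonal blocks of the repair matrix on
  \<open>I\<close>.\<close>

lemma poly_trace_poly_self: "poly (trace_poly z a) a = z"
proof -
  have "poly (trace_poly z a) a = (\<Sum>s<t. if s = 0 then z else 0)"
    unfolding trace_poly_def poly_sum
  proof (intro sum.cong refl)
    fix s
    show "poly (smult (z ^ (q ^ s)) ([:- a, 1:] ^ (q ^ s - 1))) a = (if s = 0 then z else 0)"
      using one_less_power[of q s] q_ge_2 by (auto simp: zero_power)
  qed
  then show ?thesis using t_pos by simp
qed

section \<open>Collision points and the greedy choice of multipliers\<close>

text \<open>Away from \<open>a i\<close> and \<open>a j\<close> these are the points where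
  \<open>\<delta> i / (x - a i)\<close> and \<open>\<delta> j / (x - a j)\<close> are proportional
  over \<open>B\<close>. Denominators are cleared so that division by zero cannot interfere.\<close>

definition collisions :: "(nat \<Rightarrow> 'a) \<Rightarrow> (nat \<Rightarrow> 'a) \<Rightarrow> nat \<Rightarrow> nat \<Rightarrow> 'a set" where
  "collisions a \<delta> i j = {x. \<exists>\<gamma>\<in>B - {0}. \<delta> i * (x - a j) = \<gamma> * (\<delta> j * (x - a i))}"

text \<open>
  The trace condition makes the block matrix \<open>M[I,:]\<close> behave like a triangular one. It is linear
  in \<open>\<delta> j\<close>, so that \<open>\<delta>\<close> can be chosen greedily.
\<close>

definition admissible :: "(nat \<Rightarrow> 'a) \<Rightarrow> nat \<Rightarrow> nat \<Rightarrow> (nat \<Rightarrow> 'a) \<Rightarrow> bool" where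
  "admissible a r m \<delta> \<longleftrightarrow>
     (\<forall>i<m. \<delta> i \<noteq> 0) \<and>
     (\<forall>j<m. \<forall>i<j. \<forall>l<r. i < l \<longrightarrow> trace (\<delta> j * ((a l - a i) / (\<delta> i * (a i - a j)))) = 0) \<and>
     (\<forall>j<m. \<forall>i<j. \<delta> i / \<delta> j \<notin> B) \<and>
     (\<forall>j<m. \<forall>i<j. collisions a \<delta> i j \<inter> a ` {..<r} = {}) \<and>
     (\<forall>j<m. \<forall>i<j. \<forall>j'<m. \<forall>i'<j'. (i, j) \<noteq> (i', j') \<longrightarrow>
        collisions a \<delta> i j \<inter> collisions a \<delta> i' j' = {})"

lemma admissibleD:
  assumes "admissible a r m \<delta>"
  shows "i < m \<Longrightarrow> \<delta> i \<noteq> 0"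
    and "i < j \<Longrightarrow> j < m \<Longrightarrow> i < l \<Longrightarrow> l < r \<Longrightarrow>
      trace (\<delta> j * ((a l - a i) / (\<delta> i * (a i - a j)))) = 0"
    and "i < j \<Longrightarrow> j < m \<Longrightarrow> \<delta> i / \<delta> j \<notin> B"
    and "i < j \<Longrightarrow> j < m \<Longrightarrow> collisions a \<delta> i j \<inter> a ` {..<r} = {}"
    and "i < j \<Longrightarrow> j < m \<Longrightarrow> i' < j' \<Longrightarrow> j' < m \<Longrightarrow> (i, j) \<noteq> (i', j') \<Longrightarrow>
      collisions a \<delta> i j \<inter> collisions a \<delta> i' j' = {}"
  using assms unfolding admissible_def by simp_all

lemma B_Diff_0_inverse: "\<gamma> \<in> B - {0} \<Longrightarrow> inverse \<gamma> \<in> B - {0}"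
  by (simp add: B_closed(6))

text \<open>For each nonzero \<open>\<gamma>\<close> in \<open>B\<close> the equation is linear in
  \<open>x\<close>, and its leading coefficient \<open>\<delta> i - \<gamma> * \<delta> j\<close> is
  nonzero because the ratio is not in \<open>B\<close>. The solution \<open>x\<close> differs from
  \<open>a i\<close>, so it determines \<open>\<gamma>\<close>.\<close>

lemma card_collisions:
  assumes "\<delta> i \<noteq> 0" "\<delta> j \<noteq> 0" "a i \<noteq> a j" "\<delta> i / \<delta> j \<notin> B"
  shows "card (collisions a \<delta> i j) = q - 1"
proof -
  have nz: "\<delta> i - \<gamma> * \<delta> j \<noteq> 0" if "\<gamma> \<in> B" for \<gamma>
    using assms that by (auto simp: field_simps)
  have iff: "\<delta> i * (x - a j) = \<gamma> * (\<delta> j * (x - a i)) \<longleftrightarrow>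
      x = (\<delta> i * a j - \<gamma> * \<delta> j * a i) / (\<delta> i - \<gamma> * \<delta> j)" if "\<gamma> \<in> B" for \<gamma> x
    using nz[OF that] by (simp add: eq_divide_eq) (auto simp: algebra_simps)
  let ?x = "\<lambda>\<gamma>. (\<delta> i * a j - \<gamma> * \<delta> j * a i) / (\<delta> i - \<gamma> * \<delta> j)"
  have "inj_on ?x (B - {0})"
  proof (rule inj_onI)
    fix \<gamma> \<gamma>' assume *: "\<gamma> \<in> B - {0}" "\<gamma>' \<in> B - {0}" "?x \<gamma> = ?x \<gamma>'"
    define x where "x = ?x \<gamma>"
    have eq: "\<delta> i * (x - a j) = \<gamma> * (\<delta> j * (x - a i))" "\<delta> i * (x - a j) = \<gamma>' * (\<delta> j * (x - a i))"
      by (rule iff[THEN iffD2]; use * in \<open>simp add: x_def\<close>)+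
    have "x \<noteq> a i" using eq(1) assms by auto
    then show "\<gamma> = \<gamma>'" using eq assms by auto
  qed
  moreover have "collisions a \<delta> i j = ?x ` (B - {0})"
    unfolding collisions_def image_def using iff by (intro Collect_cong bex_cong refl) simp
  ultimately show ?thesis
    using B_closed(1) by (simp add: card_image)
qed

lemma card_collisions_admissible:
  assumes "admissible a r m \<delta>" "inj_on a {..<m}" "i < j" "j < m"
  shows "card (collisions a \<delta> i j) = q - 1"
  using admissibleD[OF assms(1)] inj_on_eq_iff[OF assms(2), of i j] assms(3,4)
  by (intro card_collisions) auto

text \<open>Proportionality over \<open>B\<close> is transitive. In the greedy step this reduces an
  overlap of two pairs sharing the new index \<open>m\<close> to a collision of an old pair.\<close>

lemma collisions_trans:
  assumes "\<delta> i \<noteq> 0" "\<delta> i' \<noteq> 0" "\<delta> m \<noteq> 0" "a i \<noteq> a m" "a i' \<noteq> a m"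
    and "x \<in> collisions a \<delta> i m" "x \<in> collisions a \<delta> i' m"
  shows "x \<in> collisions a \<delta> i i'"
proof -
  obtain \<gamma> \<gamma>' where g: "\<gamma> \<in> B - {0}" "\<gamma>' \<in> B - {0}"
    "\<delta> i * (x - a m) = \<gamma> * (\<delta> m * (x - a i))" "\<delta> i' * (x - a m) = \<gamma>' * (\<delta> m * (x - a i'))"
    using assms(6,7) unfolding collisions_def by blast
  \<comment> \<open>At \<open>x = a m\<close> the left side of the first equation would vanish, but
    its right side would not.\<close>
  have "x \<noteq> a m" using g assms by auto
  have "\<delta> m * (x - a m) * (\<gamma>' * (\<delta> i * (x - a i'))) = (\<delta> i * (x - a m)) * (\<gamma>' * (\<delta> m * (x - a i')))"
    by (simp add: algebra_simps)
  also have "\<dots> = \<delta> m * (x - a m) * (\<gamma> * (\<delta> i' * (x - a i)))"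
    unfolding g(3) g(4)[symmetric] by (simp add: algebra_simps)
  finally have "\<gamma>' * (\<delta> i * (x - a i')) = \<gamma> * (\<delta> i' * (x - a i))"
    using \<open>x \<noteq> a m\<close> assms(3) by simp
  then have "\<delta> i * (x - a i') = (\<gamma> * inverse \<gamma>') * (\<delta> i' * (x - a i))"
    using g(2) by (simp add: field_simps)
  moreover have "\<gamma> * inverse \<gamma>' \<in> B - {0}"
    using g(1,2) B_closed(4,6) by auto
  ultimately show ?thesis unfolding collisions_def by blast
qed

text \<open>The hypothesis \<open>eq\<close> is the kernel equation of the matrix on
  \<open>I\<close>, with the \<open>t\<close> coordinates of block \<open>j\<close> gathered into
  the field element \<open>z j\<close>. Two inductions, one upward and one downward, mimic the
  solution of a triangular system.\<close>

lemma admissible_imp_full_rank: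
  assumes adm: "admissible a r r \<delta>" and inj: "inj_on a {..<r}"
    and eq: "\<And>i. i < r \<Longrightarrow>
      \<delta> i * z i + (\<Sum>j\<in>{..<r} - {i}. \<delta> j * (trace (z j * (a i - a j)) / (a i - a j))) = 0"
  shows "i < r \<Longrightarrow> z i = 0"
proof -
  define c where "c i j = trace (z j * (a i - a j))" for i j
  have c_B: "c i j \<in> B" for i j unfolding c_def by (rule trace_in_B)
  note nz = admissibleD(1)[OF adm]
  have z: "z i = - (\<Sum>j\<in>{..<r} - {i}. c i j * (\<delta> j / (\<delta> i * (a i - a j))))" if "i < r" for i
  proof -
    have "\<delta> i * z i = - (\<Sum>j\<in>{..<r} - {i}. \<delta> j * (c i j / (a i - a j)))"
      using eq[OF that] by (simp add: c_def eq_neg_iff_add_eq_0)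
    then have "z i = - (\<Sum>j\<in>{..<r} - {i}. \<delta> j * (c i j / (a i - a j))) / \<delta> i"
      using nz[OF that] by (simp add: field_simps)
    then show ?thesis
      by (simp add: sum_divide_distrib mult_ac)
  qed
  \<comment> \<open>Upward induction on \<open>i\<close>: insert the formula for \<open>z i\<close>
    and take the trace. Terms with \<open>j < i\<close> vanish by induction, since
    \<open>c i j = 0\<close>; those with \<open>j > i\<close> vanish by the trace condition.\<close>
  have c_0: "c l i = 0" if "i < l" "l < r" for i l
    using that
  proof (induction i arbitrary: l rule: less_induct)
    case (less i)
    then have "i < r" by simp
    have "c l i = trace (- (\<Sum>j\<in>{..<r} - {i}. c i j * (\<delta> j / (\<delta> i * (a i - a j)))) * (a l - a i))"
      unfolding c_def[of l i] using z[OF \<open>i < r\<close>] by simp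
    also have "\<dots> = trace (- (\<Sum>j\<in>{..<r} - {i}. c i j * (\<delta> j * ((a l - a i) / (\<delta> i * (a i - a j))))))"
      by (simp only: mult_minus_left sum_distrib_right) (simp add: mult_ac)
    also have "\<dots> = - (\<Sum>j\<in>{..<r} - {i}. c i j * trace (\<delta> j * ((a l - a i) / (\<delta> i * (a i - a j)))))"
      by (simp only: trace_minus trace_sum trace_scale[OF c_B])
    also have "\<dots> = 0"
    proof -
      have "c i j * trace (\<delta> j * ((a l - a i) / (\<delta> i * (a i - a j)))) = 0" if "j < r" "j \<noteq> i" for j
      proof (cases "j < i")
        case True
        then show ?thesis using less.IH[OF True True \<open>i < r\<close>] by simp
      next
        case False
        then have "trace (\<delta> j * ((a l - a i) / (\<delta> i * (a i - a j)))) = 0"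
          using admissibleD(2)[OF adm, of i j l] less.prems that by simp
        then show ?thesis by simp
      qed
      then show ?thesis by (simp add: sum.neutral)
    qed
    finally show ?case .
  qed
  \<comment> \<open>Downward induction: in the formula for \<open>z i\<close> the terms with
    \<open>j < i\<close> vanish by \<open>c_0\<close>, those with \<open>j > i\<close> because
    \<open>z j = 0\<close>.\<close>
  show "z i = 0" if "i < r" for i
    using that
  proof (induction "r - i" arbitrary: i rule: less_induct)
    case less
    have "c i j = 0" if "j < r" "j \<noteq> i" for j
    proof (cases "j < i")
      case True
      then show ?thesis using c_0 less.prems by blast
    next
      case False
      then have "z j = 0" using less.hyps[of j] less.prems that by simp
      then show ?thesis by (simp add: c_def)
    qed
    then show ?case using z[OF less.prems] by (simp add: sum.neutral)
  qed
qed

text \<open>The conditions are linear over \<open>B\<close> with values in \<open>B\<close>, so at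
  least \<open>CARD('a) / q ^ card C\<close> elements satisfy them, which is more than
  \<open>E\<close> can hold.\<close>

lemma exists_avoiding:
  assumes "finite C" and small: "q ^ card C * card E < CARD('a)"
  shows "\<exists>d. d \<notin> E \<and> (\<forall>l\<in>C. trace (d * u l) = 0)"
proof -
  define V where "V = {d. \<forall>l\<in>C. trace (d * u l) = 0}"
  have "CARD('a) \<le> card V * q ^ card C"
    unfolding V_def using assms
    by (intro card_le_card_kernel_mult) (auto simp: distrib_right trace_add trace_in_B)
  then have "q ^ card C * card E < q ^ card C * card V"
    using small by (simp only: mult.commute)
  then have "card E < card V" by simp
  then have "\<not> V \<subseteq> E"
    using card_mono[of E V] by (auto simp: not_le[symmetric])
  then show ?thesis by (auto simp: V_def)
qed

lemma choose_two_mono: "m \<le> n \<Longrightarrow> m choose 2 \<le> n choose 2"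
  by (simp add: choose_two div_le_mono diff_le_mono mult_le_mono)

lemma admissible_step:
  assumes adm: "admissible a r m \<delta>" and inj: "inj_on a {..<r}" and "m < r"
    and big: "q ^ (r choose 2) * (r * (r + (r choose 2) * (q - 1)) * (q - 1) + 1) < CARD('a)"
  shows "\<exists>\<delta>. admissible a r (Suc m) \<delta>"
proof -
  let ?P = "{(i, j). i < j \<and> j < m}"
  let ?U = "\<Union>(i, j)\<in>?P. collisions a \<delta> i j"
  let ?A = "a ` {..<r}"
  \<comment> \<open>One trace condition on the new multiplier for each such pair
    \<open>(i, l)\<close>.\<close>
  define C where "C = {(i, l). i < m \<and> i < l \<and> l < r}"
  \<comment> \<open>Forbidden values of the new multiplier: 0, those whose ratio with an old
    \<open>\<delta> i\<close> is in \<open>B\<close>, and those for which the pair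
    \<open>(i, m)\<close> would collide at a given point or at an old collision point.\<close>
  define E where "E = insert 0 (\<Union>(i, \<gamma>)\<in>{..<m} \<times> (B - {0}).
    insert (\<gamma> * \<delta> i) ((\<lambda>x. \<gamma> * (\<delta> i * (x - a m) / (x - a i))) ` (?A \<union> ?U)))"
  have finP: "finite ?P" "finite {(i, j). i < j \<and> j < r}"
    by (rule finite_subset[of _ "{..<m+r} \<times> {..<m+r}"]; auto)+
  note nz = admissibleD(1)[OF adm]
  have a_eq: "a i = a j \<longleftrightarrow> i = j" if "i < r" "j < r" for i j
    using inj_on_eq_iff[OF inj] that by simp
  have cardC: "card C \<le> r choose 2"
    unfolding card_pairs_less[of r, symmetric] C_def by (intro card_mono finP) auto
  have cardU: "card ?U \<le> (m choose 2) * (q - 1)"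
  proof -
    have "card ?U \<le> (\<Sum>(i, j)\<in>?P. card (collisions a \<delta> i j))"
      using card_UN_le[OF finP(1), of "\<lambda>(i, j). collisions a \<delta> i j"] by (simp add: case_prod_unfold)
    also have "\<dots> = (\<Sum>(i, j)\<in>?P. q - 1)"
    proof (intro sum.cong refl, clarify)
      fix i j assume "i < j" "j < m"
      then show "card (collisions a \<delta> i j) = q - 1"
        using adm inj_on_subset[OF inj, of "{..<m}"] \<open>m < r\<close> by (intro card_collisions_admissible) auto
    qed
    finally show ?thesis by (simp add: card_pairs_less)
  qed
  have "card E \<le> r * (r + (r choose 2) * (q - 1)) * (q - 1) + 1"
  proof -
    have "card (insert (\<gamma> * \<delta> i) ((\<lambda>x. \<gamma> * (\<delta> i * (x - a m) / (x - a i))) ` (?A \<union> ?U)))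
        \<le> 1 + r + (m choose 2) * (q - 1)" for \<gamma> i
    proof -
      have "card (?A \<union> ?U) \<le> r + (m choose 2) * (q - 1)"
        using card_Un_le[of ?A ?U] card_image_le[of "{..<r}" a] cardU by simp
      then show ?thesis
        using card_image_le[of "?A \<union> ?U" "\<lambda>x. \<gamma> * (\<delta> i * (x - a m) / (x - a i))"]
        by (intro order_trans[OF card_insert_le_m1]) auto
    qed
    then have "card E \<le> 1 + card ({..<m} \<times> (B - {0})) * (1 + r + (m choose 2) * (q - 1))"
      unfolding E_def case_prod_unfold
      by (intro order_trans[OF card_insert_le_m1] le_refl)
        (auto intro!: order_trans[OF card_UN_le] sum_bounded_above[THEN order_trans] simp del: card_cartesian_product)
    also have "card ({..<m} \<times> (B - {0})) = m * (q - 1)"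
      using B_closed(1) by (simp add: card_cartesian_product)
    also have "1 + m * (q - 1) * (1 + r + (m choose 2) * (q - 1))
        \<le> r * (r + (r choose 2) * (q - 1)) * (q - 1) + 1"
    proof -
      \<comment> \<open>The strict inequality \<open>m < r\<close> absorbs the extra 1, so one bound
        serves every step.\<close>
      have "m * (1 + r + (m choose 2) * (q - 1)) \<le> r * (r + (r choose 2) * (q - 1))"
      proof -
        obtain e where r: "r = Suc (m + e)" using \<open>m < r\<close> less_imp_Suc_add by blast
        have "m * (1 + r) \<le> r * r" by (simp add: r algebra_simps)
        moreover have "m * ((m choose 2) * (q - 1)) \<le> r * ((r choose 2) * (q - 1))"
          using \<open>m < r\<close> by (intro mult_mono choose_two_mono) auto
        ultimately show ?thesis unfolding distrib_left by linarith
      qed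
      from mult_right_mono[OF this, of "q - 1"]
      have "m * (q - 1) * (1 + r + (m choose 2) * (q - 1)) \<le> r * (r + (r choose 2) * (q - 1)) * (q - 1)"
        by (simp only: mult_ac)
      then show ?thesis by linarith
    qed
    finally show ?thesis .
  qed
  then have "q ^ card C * card E \<le> q ^ (r choose 2) * (r * (r + (r choose 2) * (q - 1)) * (q - 1) + 1)"
    using cardC q_ge_2 by (intro mult_mono power_increasing) auto
  then have small: "q ^ card C * card E < CARD('a)" using big by linarith
  have "finite C"
    unfolding C_def by (rule finite_subset[OF _ finP(2)]) auto
  obtain d where d: "d \<notin> E \<and> (\<forall>p\<in>C. trace (d * ((a (snd p) - a (fst p)) / (\<delta> (fst p) * (a (fst p) - a m)))) = 0)"
    using exists_avoiding[OF \<open>finite C\<close> small] ..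
  then have "d \<notin> E" ..
  have "d \<noteq> 0" using \<open>d \<notin> E\<close> by (auto simp: E_def)
  let ?\<delta> = "\<delta>(m := d)"
  have coll_old: "collisions a ?\<delta> i j = collisions a \<delta> i j" if "i < m" "j < m" for i j
    using that by (simp add: collisions_def)
  have ratio: "\<delta> i / d \<notin> B" if "i < m" for i
  proof
    assume "\<delta> i / d \<in> B"
    then have "inverse (\<delta> i / d) \<in> B - {0}"
      using nz[OF that] \<open>d \<noteq> 0\<close> by (intro B_Diff_0_inverse) simp
    moreover have "d = inverse (\<delta> i / d) * \<delta> i" using nz[OF that] by simp
    ultimately have "d \<in> E" unfolding E_def using that by blast
    then show False using \<open>d \<notin> E\<close> by blast
  qed
  \<comment> \<open>A collision at \<open>x\<close> can be solved for \<open>d\<close>, which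
    exhibits \<open>d\<close> as an element of \<open>E\<close>.\<close>
  have coll_new: "x \<notin> ?A \<union> ?U" if "i < m" and coll: "x \<in> collisions a ?\<delta> i m" for i x
  proof
    assume x: "x \<in> ?A \<union> ?U"
    obtain \<gamma> where g: "\<gamma> \<in> B - {0}" "\<delta> i * (x - a m) = \<gamma> * (d * (x - a i))"
      using coll \<open>i < m\<close> by (auto simp: collisions_def)
    have "x \<noteq> a i" using g(2) nz[OF that(1)] a_eq[of i m] that(1) \<open>m < r\<close> by auto
    then have "d = inverse \<gamma> * (\<delta> i * (x - a m) / (x - a i))"
      using g by (simp add: field_simps)
    moreover have "inverse \<gamma> \<in> B - {0}" using g(1) by (rule B_Diff_0_inverse)
    ultimately have "d \<in> E" unfolding E_def using that x by blast
    then show False using \<open>d \<notin> E\<close> by blast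
  qed
  \<comment> \<open>Both sets depend on \<open>d\<close>, so no value was excluded for this case;
    transitivity moves a common point into \<open>?U\<close>, where \<open>coll_new\<close>
    applies.\<close>
  have new_new: "collisions a ?\<delta> i m \<inter> collisions a ?\<delta> i' m = {}" if "i < i'" "i' < m" for i i'
  proof -
    have False if "x \<in> collisions a ?\<delta> i m" "x \<in> collisions a ?\<delta> i' m" for x
    proof -
      have "x \<in> collisions a ?\<delta> i i'"
        using that \<open>i < i'\<close> \<open>i' < m\<close> \<open>m < r\<close> nz \<open>d \<noteq> 0\<close> a_eq by (intro collisions_trans[of ?\<delta> i i' m a]) auto
      then have "x \<in> ?U" using coll_old[of i i'] \<open>i < i'\<close> \<open>i' < m\<close> by auto
      then show False using coll_new[OF _ that(2)] \<open>i' < m\<close> by blast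
    qed
    then show ?thesis by blast
  qed
  have new_old: "collisions a ?\<delta> i m \<inter> collisions a \<delta> i' j' = {}" if "i < m" "i' < j'" "j' < m" for i i' j'
    using coll_new[OF that(1)] that(2,3) by blast
  have "admissible a r (Suc m) ?\<delta>"
    unfolding admissible_def
  proof (intro conjI allI impI)
    fix i assume "i < Suc m"
    then show "?\<delta> i \<noteq> 0" using nz \<open>d \<noteq> 0\<close> by (auto simp: less_Suc_eq)
  next
    fix i j l assume "j < Suc m" "i < j" "l < r" "i < l"
    then show "trace (?\<delta> j * ((a l - a i) / (?\<delta> i * (a i - a j)))) = 0"
      using admissibleD(2)[OF adm, of i j l] bspec[OF conjunct2[OF d], of "(i, l)"] by (cases "j = m") (auto simp: C_def)
  next
    fix i j assume "j < Suc m" "i < j"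
    then show "?\<delta> i / ?\<delta> j \<notin> B"
      using admissibleD(3)[OF adm, of i j] ratio by (cases "j = m") auto
  next
    fix i j assume ij: "j < Suc m" "i < j"
    show "collisions a ?\<delta> i j \<inter> ?A = {}"
    proof (cases "j = m")
      case True
      then show ?thesis using coll_new[of i] ij by blast
    next
      case False
      then show ?thesis using admissibleD(4)[OF adm, of i j] ij coll_old[of i j] by simp
    qed
  next
    fix i j i' j' assume *: "j < Suc m" "i < j" "j' < Suc m" "i' < j'" "(i, j) \<noteq> (i', j')"
    consider "j = m" "j' = m" | "j = m" "j' < m" | "j < m" "j' = m" | "j < m" "j' < m"
      using * by linarith
    then show "collisions a ?\<delta> i j \<inter> collisions a ?\<delta> i' j' = {}"
    proof cases
      case 1
      then show ?thesis using new_new[of i i'] new_new[of i' i] * by (cases i i' rule: linorder_cases) auto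
    next
      case 2
      then show ?thesis using new_old[of i i' j'] coll_old[of i' j'] * by simp
    next
      case 3
      then show ?thesis using new_old[of i' i j] coll_old[of i j] * by (simp add: Int_commute)
    next
      case 4
      then show ?thesis
        using admissibleD(5)[OF adm, of i j i' j'] coll_old[of i' j'] coll_old[of i j] * by simp
    qed
  qed
  then show ?thesis by (rule exI[of _ ?\<delta>])
qed

lemma exists_admissible:
  assumes "inj_on a {..<r}"
    and "q ^ (r choose 2) * (r * (r + (r choose 2) * (q - 1)) * (q - 1) + 1) < CARD('a)"
  shows "\<exists>\<delta>. admissible a r r \<delta>"
proof -
  have "\<exists>\<delta>. admissible a r m \<delta>" if "m \<le> r" for m
    using that
  proof (induction m)
    case 0
    show ?case by (simp add: admissible_def)
  next
    case (Suc m)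
    then show ?case using admissible_step assms by (metis Suc_leD Suc_le_lessD)
  qed
  then show ?thesis by blast
qed

section \<open>Counting the bandwidth\<close>

text \<open>The collision sets are disjoint, avoid the points of \<open>I\<close> and have
  \<open>q - 1\<close> elements each. Their union therefore has
  \<open>(q - 1) * (r choose 2)\<close> points, each saving one dimension against the bound
  \<open>r\<close>.\<close>

lemma sum_dim_le:
  fixes D :: "'a \<Rightarrow> nat"
  assumes adm: "admissible a r r \<delta>" and inj: "inj_on a {..<r}"
    and D: "\<And>x. x \<notin> a ` {..<r} \<Longrightarrow> D x \<le> r"
    and D': "\<And>x i j. i < j \<Longrightarrow> j < r \<Longrightarrow> x \<in> collisions a \<delta> i j \<Longrightarrow> D x \<le> r - 1"
  shows "(\<Sum>x\<in>UNIV - a ` {..<r}. D x) + (q - 1) * (r choose 2) \<le> (CARD('a) - r) * r"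
proof -
  let ?P = "{(i, j). i < j \<and> j < r}"
  let ?X = "UNIV - a ` {..<r}"
  define U where "U = (\<Union>(i, j)\<in>?P. collisions a \<delta> i j)"
  have finP: "finite ?P"
    by (rule finite_subset[of _ "{..<r} \<times> {..<r}"]) auto
  have "card U = (\<Sum>(i, j)\<in>?P. card (collisions a \<delta> i j))"
  proof -
    have "card U = (\<Sum>p\<in>?P. card (case p of (i, j) \<Rightarrow> collisions a \<delta> i j))"
      unfolding U_def using finP admissibleD(5)[OF adm]
      by (intro card_UN_disjoint) (simp_all split: prod.splits)
    then show ?thesis by (simp add: case_prod_unfold)
  qed
  also have "\<dots> = (\<Sum>(i, j)\<in>?P. q - 1)"
  proof (intro sum.cong refl, clarify)
    fix i j assume "i < j" "j < r"
    then show "card (collisions a \<delta> i j) = q - 1"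
      by (rule card_collisions_admissible[OF adm inj])
  qed
  finally have cardU: "card U = (q - 1) * (r choose 2)"
    by (simp add: card_pairs_less mult.commute)
  have U: "U \<subseteq> ?X" using admissibleD(4)[OF adm] unfolding U_def by blast
  have "(\<Sum>x\<in>?X. D x) + card U = (\<Sum>x\<in>?X. D x) + (\<Sum>x\<in>?X. if x \<in> U then 1 else 0)"
    using U by (simp add: sum.If_cases Int_absorb2 inf_commute)
  also have "\<dots> = (\<Sum>x\<in>?X. D x + (if x \<in> U then 1 else 0))"
    by (simp add: sum.distrib)
  also have "\<dots> \<le> (\<Sum>x\<in>?X. r)"
  proof (rule sum_mono)
    fix x assume x: "x \<in> ?X"
    show "D x + (if x \<in> U then 1 else 0) \<le> r"
    proof (cases "x \<in> U")
      case True
      then obtain i j where "i < j" "j < r" "x \<in> collisions a \<delta> i j" unfolding U_def by blast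
      then show ?thesis using D'[of i j x] True by simp
    qed (use D x in simp)
  qed
  also have "\<dots> = (CARD('a) - r) * r"
    using inj by (simp add: card_Diff_subset card_image)
  finally show ?thesis using cardU by simp
qed

end

section \<open>Assembling the repair matrix\<close>

lemma sum_lessThan_mult:
  "(\<Sum>c<m * n. f c) = (\<Sum>j<m. \<Sum>s<n. f (j * n + s :: nat) :: 'a::comm_monoid_add)"
proof -
  have "(\<Sum>c<m * n. f c) = (\<Sum>j<m. sum f {j * n..<j * n + n})"
    by (rule sum.nat_group[symmetric])
  also have "\<dots> = (\<Sum>j<m. \<Sum>s<n. f (j * n + s))"
    by (rule sum.cong[OF refl]) (simp add: sum.atLeastLessThan_shift_0[of f "_ * n"] lessThan_atLeast0)
  finally show ?thesis .
qed

lemma pick_image: "pick I ` {..<card I} = I" if "finite I"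
proof (rule card_subset_eq[OF that])
  have "inj_on (pick I) {..<card I}"
    by (rule strict_mono_on_imp_inj_on, rule strict_mono_onI) (simp add: pick_mono)
  then show "card (pick I ` {..<card I}) = card I" by (simp add: card_image)
  show "pick I ` {..<card I} \<subseteq> I" by (auto intro: pick_in_set)
qed

text \<open>A product with a message polynomial has degree below \<open>CARD('a) - 1\<close>, so its
  values over the whole field sum to 0.\<close>

lemma evaluations_in_dual_reed_solomon:
  fixes \<alpha> :: "nat \<Rightarrow> 'a::{field,finite}"
  assumes "bij_betw \<alpha> {..<n} UNIV" and deg: "degree p + k < CARD('a)"
  shows "vec n (\<lambda>i. poly p (\<alpha> i)) \<in> dual_code n (reed_solomon n k \<alpha>)"
proof -
  have "vec n (\<lambda>i. poly f (\<alpha> i)) \<bullet> vec n (\<lambda>i. poly p (\<alpha> i)) = 0" if "f = 0 \<or> degree f < k" for f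
  proof -
    have "vec n (\<lambda>i. poly f (\<alpha> i)) \<bullet> vec n (\<lambda>i. poly p (\<alpha> i)) = (\<Sum>i<n. poly (f * p) (\<alpha> i))"
      by (simp add: scalar_prod_def lessThan_atLeast0)
    also have "\<dots> = (\<Sum>x\<in>UNIV. poly (f * p) x)"
      using assms(1) by (rule sum.reindex_bij_betw)
    also have "\<dots> = 0"
    proof (cases "f = 0")
      case False
      then show ?thesis
        using that deg degree_mult_le[of f p] by (intro sum_poly_UNIV_eq_0) linarith
    qed simp
    finally show ?thesis .
  qed
  then show ?thesis by (auto simp: dual_code_def reed_solomon_def)
qed

context finite_field_over_subfield
begin

text \<open>By linearity of the trace over \<open>B\<close>, the columns of a block combine as one
  trace polynomial with parameter \<open>\<Sum>s<t. x s * \<zeta> s\<close>.\<close>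

lemma sum_scaled_trace_poly:
  assumes "\<And>s. s < t \<Longrightarrow> x s \<in> B"
  shows "(\<Sum>s<t. x s * poly (trace_poly (\<zeta> s) b) y) =
    (if y = b then \<Sum>s<t. x s * \<zeta> s else trace ((\<Sum>s<t. x s * \<zeta> s) * (y - b)) / (y - b))"
proof (cases "y = b")
  case False
  have "(\<Sum>s<t. x s * poly (trace_poly (\<zeta> s) b) y) = (\<Sum>s<t. trace (x s * (\<zeta> s * (y - b)))) / (y - b)"
    unfolding sum_divide_distrib
    by (intro sum.cong refl) (simp add: poly_trace_poly_eq[OF False] trace_scale assms)
  then show ?thesis
    using False by (simp add: trace_sum[symmetric] sum_distrib_right mult.assoc)
qed (simp add: poly_trace_poly_self)

lemma exists_multiple_repair_matrix:
  assumes bij: "bij_betw \<alpha> {..<CARD('a)} UNIV" and k: "k + q ^ (t - 1) = q ^ t"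
    and I: "I \<subseteq> {..<CARD('a)}" "card I = r"
    and big: "q ^ (r choose 2) * (r * (r + (r choose 2) * (q - 1)) * (q - 1) + 1) < CARD('a)"
  shows "\<exists>M\<in>carrier_mat CARD('a) (r * t). \<exists>b.
    multiple_repair_matrix B t CARD('a) (reed_solomon CARD('a) k \<alpha>) I b M \<and>
    b + (q - 1) * (r choose 2) \<le> (CARD('a) - r) * r"
proof -
  let ?n = "CARD('a)"
  have "finite I" using I(1) finite_subset by blast
  \<comment> \<open>\<open>pick\<close> lists \<open>I\<close> in increasing order, the order in
    which \<open>submatrix\<close> keeps the rows.\<close>
  define a where "a i = \<alpha> (pick I i)" for i
  have a_image: "a ` {..<r} = \<alpha> ` I"
    unfolding a_def using pick_image[OF \<open>finite I\<close>] I(2) by (metis image_image)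
  have inj_\<alpha>: "inj_on \<alpha> {..<?n}" using bij by (rule bij_betw_imp_inj_on)
  have "card (\<alpha> ` I) = r" using inj_on_subset[OF inj_\<alpha> I(1)] I(2) by (simp add: card_image)
  then have inj: "inj_on a {..<r}" by (intro eq_card_imp_inj_on) (simp_all add: a_image)
  obtain \<delta> where adm: "admissible a r r \<delta>" using exists_admissible[OF inj big] by blast
  obtain \<zeta> :: "nat \<Rightarrow> 'a" where
    indep: "\<And>x. (\<forall>s<t. x s \<in> B) \<Longrightarrow> (\<Sum>s<t. x s * \<zeta> s) = 0 \<Longrightarrow> \<forall>s<t. x s = 0"
    using exists_basis_of_type[OF subfield dimension] by metis
  \<comment> \<open>Column \<open>c = j * t + s\<close> belongs to the multiplier
    \<open>\<delta> j\<close> and the basis element \<open>\<zeta> s\<close>.\<close>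
  define g where "g c = smult (\<delta> (c div t)) (trace_poly (\<zeta> (c mod t)) (a (c div t)))" for c
  define M where "M = mat ?n (r * t) (\<lambda>(i, c). poly (g c) (\<alpha> i))"
  define D where "D x = ring.dim ring_of_type_algebra B
    (ring.Span ring_of_type_algebra B (map (\<lambda>c. poly (g c) x) [0..<r * t]))" for x
  define b where "b = (\<Sum>j\<in>{..<?n} - I. ring.dim ring_of_type_algebra B (entries_span B (row M j)))"
  have M: "M \<in> carrier_mat ?n (r * t)" by (simp add: M_def)
  have dual: "col M c \<in> dual_code ?n (reed_solomon ?n k \<alpha>)" if "c < r * t" for c
  proof -
    have "degree (g c) \<le> q ^ (t - 1) - 1"
      unfolding g_def by (rule order_trans[OF degree_smult_le degree_trace_poly])
    moreover have "0 < q ^ (t - 1)" using q_ge_2 by simp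
    ultimately have "degree (g c) + k < ?n" using k card_field by linarith
    moreover have "col M c = vec ?n (\<lambda>i. poly (g c) (\<alpha> i))"
      using that by (auto simp: M_def)
    ultimately show ?thesis by (simp only: evaluations_in_dual_reed_solomon[OF bij])
  qed
  have full_rank: "submatrix M I UNIV *\<^sub>v x \<noteq> 0\<^sub>v r"
    if x: "x \<in> carrier_vec (r * t)" "set\<^sub>v x \<subseteq> B" "x \<noteq> 0\<^sub>v (r * t)" for x
  proof
    assume ker: "submatrix M I UNIV *\<^sub>v x = 0\<^sub>v r"
    have idx: "j * t + s < r * t" if "j < r" "s < t" for j s
    proof -
      have "j * t + s < Suc j * t" using that by simp
      also have "\<dots> \<le> r * t" using that by (intro mult_le_mono1) simp
      finally show ?thesis .
    qed
    have x_B: "x $ (j * t + s) \<in> B" if "j < r" "s < t" for j s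
      using idx[OF that] x(1,2) vec_setI[of x "j * t + s"] by auto
    define z where "z j = (\<Sum>s<t. x $ (j * t + s) * \<zeta> s)" for j
    have rows: "{i. i < ?n \<and> i \<in> I} = I" using I(1) by auto
    have "\<delta> i * z i + (\<Sum>j\<in>{..<r} - {i}. \<delta> j * (trace (z j * (a i - a j)) / (a i - a j))) = 0"
      if "i < r" for i
    proof -
      have pick: "pick I i < ?n" using pick_in_set[of i I] that I by auto
      have "0 = (submatrix M I UNIV *\<^sub>v x) $ i" using ker that by simp
      also have "\<dots> = (\<Sum>c<r * t. submatrix M I UNIV $$ (i, c) * x $ c)"
        using that x(1) M rows I(2)
        by (simp add: scalar_prod_def dim_submatrix lessThan_atLeast0)
      also have "\<dots> = (\<Sum>c<r * t. poly (g c) (a i) * x $ c)"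
        using that M rows I(2) pick
        by (intro sum.cong refl) (simp add: submatrix_index pick_UNIV M_def a_def)
      also have "\<dots> = (\<Sum>j<r. \<Sum>s<t. poly (g (j * t + s)) (a i) * x $ (j * t + s))"
        by (rule sum_lessThan_mult)
      also have "\<dots> = (\<Sum>j<r. \<delta> j * (if a i = a j then z j else trace (z j * (a i - a j)) / (a i - a j)))"
      proof (intro sum.cong refl)
        fix j assume "j \<in> {..<r}"
        then have "(\<Sum>s<t. x $ (j * t + s) * poly (trace_poly (\<zeta> s) (a j)) (a i)) =
          (if a i = a j then z j else trace (z j * (a i - a j)) / (a i - a j))"
          unfolding z_def by (intro sum_scaled_trace_poly x_B) auto
        moreover have "(\<Sum>s<t. poly (g (j * t + s)) (a i) * x $ (j * t + s)) =
          \<delta> j * (\<Sum>s<t. x $ (j * t + s) * poly (trace_poly (\<zeta> s) (a j)) (a i))"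
          unfolding sum_distrib_left g_def by (intro sum.cong refl) (simp add: mult_ac)
        ultimately show "(\<Sum>s<t. poly (g (j * t + s)) (a i) * x $ (j * t + s)) =
          \<delta> j * (if a i = a j then z j else trace (z j * (a i - a j)) / (a i - a j))"
          by simp
      qed
      also have "\<dots> = \<delta> i * z i + (\<Sum>j\<in>{..<r} - {i}.
          \<delta> j * (if a i = a j then z j else trace (z j * (a i - a j)) / (a i - a j)))"
        using that by (subst sum.remove[of _ i]) simp_all
      also have "(\<Sum>j\<in>{..<r} - {i}.
          \<delta> j * (if a i = a j then z j else trace (z j * (a i - a j)) / (a i - a j))) =
        (\<Sum>j\<in>{..<r} - {i}. \<delta> j * (trace (z j * (a i - a j)) / (a i - a j)))"
        using that inj_on_eq_iff[OF inj] by (intro sum.cong refl) auto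
      finally show ?thesis by simp
    qed
    then have z_0: "z j = 0" if "j < r" for j
      using admissible_imp_full_rank[OF adm inj] that by blast
    have "x $ c = 0" if "c < r * t" for c
    proof -
      \<comment> \<open>Independence of \<open>\<zeta>\<close> turns the vanishing of
        \<open>z\<close> back into that of each coordinate, located by quotient and
        remainder.\<close>
      have c: "c div t < r" "c mod t < t" using that t_pos by (simp_all add: less_mult_imp_div_less)
      have "\<forall>s<t. x $ (c div t * t + s) = 0"
        using indep[of "\<lambda>s. x $ (c div t * t + s)"] x_B c(1) z_0[OF c(1)] by (simp add: z_def)
      then have "x $ (c div t * t + c mod t) = 0" using c(2) by blast
      then show ?thesis by simp
    qed
    then show False using x(1,3) by (auto intro: eq_vecI)
  qed
  have "b = (\<Sum>j\<in>{..<?n} - I. D (\<alpha> j))"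
    unfolding b_def
  proof (intro sum.cong refl)
    fix j assume "j \<in> {..<?n} - I"
    then have "list_of_vec (row M j) = map (\<lambda>c. poly (g c) (\<alpha> j)) [0..<r * t]"
      by (intro nth_equalityI) (simp_all add: M_def list_of_vec_index)
    then show "ring.dim ring_of_type_algebra B (entries_span B (row M j)) = D (\<alpha> j)"
      by (simp only: entries_span_def D_def)
  qed
  also have "\<dots> = (\<Sum>x\<in>UNIV - a ` {..<r}. D x)"
  proof (rule sum.reindex_bij_betw)
    show "bij_betw \<alpha> ({..<?n} - I) (UNIV - a ` {..<r})"
      unfolding a_image using bij inj_\<alpha> I(1)
      by (auto simp: bij_betw_def inj_on_image_set_diff[of \<alpha> "{..<?n}"] intro: inj_on_subset)
  qed
  finally have b_eq: "b = (\<Sum>x\<in>UNIV - a ` {..<r}. D x)" .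
  \<comment> \<open>Each entry is a trace, hence an element of \<open>B\<close>, times one of the
    \<open>r\<close> elements \<open>\<delta> i / (x - a i)\<close>.\<close>
  have entry: "\<exists>i\<in>{..<r}. \<exists>\<beta>\<in>B. v = \<beta> * (\<delta> i / (x - a i))"
    if "x \<notin> a ` {..<r}" and v: "v \<in> set (map (\<lambda>c. poly (g c) x) [0..<r * t])" for x v
  proof -
    obtain c where c: "c < r * t" "v = poly (g c) x" using v by auto
    then have "c div t \<in> {..<r}" by (simp add: less_mult_imp_div_less)
    moreover from this have "x \<noteq> a (c div t)" using that(1) by blast
    then have "v = trace (\<zeta> (c mod t) * (x - a (c div t))) * (\<delta> (c div t) / (x - a (c div t)))"
      by (simp add: c(2) g_def poly_trace_poly_eq)
    ultimately show ?thesis using trace_in_B by blast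
  qed
  have "b + (q - 1) * (r choose 2) \<le> (?n - r) * r"
    unfolding b_eq
  proof (rule sum_dim_le[OF adm inj])
    fix x assume x: "x \<notin> a ` {..<r}"
    have "D x \<le> card {..<r}"
      unfolding D_def by (rule dim_Span_le_card[OF subfield _ entry[OF x]]) simp
    then show "D x \<le> r" by simp
  next
    fix x i j assume ij: "i < j" "j < r" and coll: "x \<in> collisions a \<delta> i j"
    have x: "x \<notin> a ` {..<r}" using admissibleD(4)[OF adm ij] coll by blast
    then have ne: "x \<noteq> a i" "x \<noteq> a j" using ij by auto
    obtain \<gamma> where \<gamma>: "\<gamma> \<in> B" "\<delta> i * (x - a j) = \<gamma> * (\<delta> j * (x - a i))"
      using coll by (auto simp: collisions_def)
    have w_i: "\<delta> i / (x - a i) = \<gamma> * (\<delta> j / (x - a j))"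
      using \<gamma>(2) ne by (simp add: field_simps)
    have "D x \<le> card ({..<r} - {i})"
      unfolding D_def
    proof (rule dim_Span_le_card[OF subfield])
      fix v assume "v \<in> set (map (\<lambda>c. poly (g c) x) [0..<r * t])"
      then obtain l \<beta> where v: "l \<in> {..<r}" "\<beta> \<in> B" "v = \<beta> * (\<delta> l / (x - a l))"
        using entry[OF x] by blast
      show "\<exists>l\<in>{..<r} - {i}. \<exists>\<beta>\<in>B. v = \<beta> * (\<delta> l / (x - a l))"
      proof (cases "l = i")
        case True
        then have "v = \<beta> * \<gamma> * (\<delta> j / (x - a j))" using v(3) w_i by simp
        moreover have "\<beta> * \<gamma> \<in> B" using v(2) \<gamma>(1) by (rule B_closed(4))
        moreover have "j \<in> {..<r} - {i}" using ij by simp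
        ultimately show ?thesis by blast
      qed (use v in blast)
    qed simp
    then show "D x \<le> r - 1" using ij by simp
  qed
  moreover have "multiple_repair_matrix B t ?n (reed_solomon ?n k \<alpha>) I b M"
    unfolding multiple_repair_matrix_def using M dual full_rank I(2) b_def by simp
  ultimately show ?thesis using M by blast
qed

end

theorem theorem3:
  fixes \<alpha> :: "nat \<Rightarrow> 'a::{field,finite}"
    and B :: "'a set"
    and n t k r :: nat
  assumes "n = CARD('a)"
    and "subfield B (ring_of_type_algebra :: 'a ring)"
    and "ring.dimension (ring_of_type_algebra :: 'a ring) t B UNIV"
    and "bij_betw \<alpha> {..<n} UNIV"
    and "real k = real n - real n / real (card B)"
    and "r \<ge> 2"
    and "real t > real (r choose 2) +
           log (real (card B))
             (real r * (real r + real (r choose 2) * (real (card B) - 1)) * (real (card B) - 1) + 1)"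
  shows "\<forall>I. I \<subseteq> {..<n} \<and> card I = r \<longrightarrow>
           (\<exists>M \<in> carrier_mat n (r * t). \<exists>b.
              multiple_repair_matrix B t n (reed_solomon n k \<alpha>) I b M \<and>
              int b \<le> (int n - int r) * int r - (int (card B) - 1) * int (r choose 2))"
proof (intro allI impI, elim conjE)
  fix I assume I: "I \<subseteq> {..<n}" "card I = r"
  let ?q = "card B"
  let ?N = "r * (r + (r choose 2) * (?q - 1)) * (?q - 1) + 1"
  have q: "2 \<le> ?q"
    using card_mono[of B "{0, 1}"] subfield_of_type_closed(1,2)[OF assms(2)] by simp
  have N: "real r * (real r + real (r choose 2) * (real ?q - 1)) * (real ?q - 1) + 1 = real ?N"
    using q by (simp add: of_nat_diff)
  have log_less: "real (r choose 2) + log ?q ?N < real t"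
    using assms(7) unfolding N .
  moreover have "real 1 \<le> real ?N" unfolding of_nat_le_iff by simp
  \<comment> \<open>A nonnegative logarithm makes \<open>t\<close> positive, as the locale
    demands.\<close>
  then have "0 \<le> log ?q ?N" using q by (subst zero_le_log_cancel_iff) linarith+
  ultimately have "0 < t" by linarith
  with assms(2,3) interpret finite_field_over_subfield B t
    by (rule finite_field_over_subfield.intro)
  \<comment> \<open>Raising \<open>?q\<close> to both sides of the hypothesis on \<open>t\<close>
    turns it into the integer inequality \<open>big\<close>.\<close>
  have powr_log: "real (?q ^ m * N) = ?q powr (real m + log ?q N)" if "0 < N" for m N :: nat
    using q that by (simp add: powr_add powr_realpow)
  have "real (?q ^ (r choose 2) * ?N) = ?q powr (real (r choose 2) + log ?q ?N)"
    by (rule powr_log) simp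
  also have "\<dots> < ?q powr t"
    using log_less q by (intro powr_less_mono) auto
  also have "\<dots> = real (?q ^ t)"
    using q by (simp add: powr_realpow)
  finally have big: "?q ^ (r choose 2) * ?N < CARD('a)"
    unfolding card_field by (simp only: of_nat_less_iff)
  \<comment> \<open>So \<open>n / q = q ^ (t - 1)\<close>, which turns the real equation for
    \<open>k\<close> into one between natural numbers.\<close>
  have "n = ?q * ?q ^ (t - 1)"
    using assms(1) card_field \<open>0 < t\<close> by (simp add: power_eq_if)
  then have "real k + real (?q ^ (t - 1)) = real (?q ^ t)"
    using assms(1,5) card_field q by auto
  then have "k + ?q ^ (t - 1) = ?q ^ t"
    by (metis of_nat_add of_nat_eq_iff)
  then obtain M b where M: "M \<in> carrier_mat n (r * t)"
    "multiple_repair_matrix B t n (reed_solomon n k \<alpha>) I b M"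
    and b: "b + (?q - 1) * (r choose 2) \<le> (n - r) * r"
    using exists_multiple_repair_matrix[of \<alpha> k I r] assms(1,4) I big by blast
  have "r \<le> n" using card_mono[OF _ I(1)] I(2) by simp
  have "int b + (int ?q - 1) * int (r choose 2) = int (b + (?q - 1) * (r choose 2))"
    using q by (simp add: of_nat_diff)
  also have "\<dots> \<le> int ((n - r) * r)" using b by (simp only: of_nat_le_iff)
  also have "\<dots> = (int n - int r) * int r" using \<open>r \<le> n\<close> by (simp add: of_nat_diff)
  finally have "int b \<le> (int n - int r) * int r - (int ?q - 1) * int (r choose 2)" by linarith
  then show "\<exists>M \<in> carrier_mat n (r * t). \<exists>b.
      multiple_repair_matrix B t n (reed_solomon n k \<alpha>) I b M \<and>
      int b \<le> (int n - int r) * int r - (int (card B) - 1) * int (r choose 2)"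
    using M by blast
qed

end
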